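(* Let $\mathscr{F}^3=\{[0),[1),[2)\}$ and let $\varepsilon$ be an injective monoid endomorphism of the semigroup $\boldsymbol{B}_{\omega}^{\mathscr{F}^3}$. Then $\varepsilon=\alpha_{[k]}$ for some positive integer $k$.
   Context: $\omega$ is the set of non-negative integers; for $a\in\omega$, $[a)=\{x\in\omega\colon x\geqslant a\}$. For $F\subseteq\omega$ nonempty and an integer $n$, $n+F=\{n+k\colon k\in F\}$ (a set of integers). Let $\mathscr{F}^3=\{[0),[1),[2)\}$. The semigroup $\boldsymbol{B}_{\omega}^{\mathscr{F}^3}$ is the set $\omega\times\omega\times\mathscr{F}^3$ with the associative operation $$(i_1,j_1,F_1)\cdot(i_2,j_2,F_2)=\begin{cases}(i_1-j_1+i_2,\,j_2,\,(j_1-i_2+F_1)\cap F_2), & \text{if } j_1\leqslant i_2;\\ (i_1,\,j_1-i_2+j_2,\,F_1\cap(i_2-j_1+F_2)), & \text{if } j_1\geqslant i_2.\end{cases}$$ It is a monoid with identity $(0,0,[0))$. An endomorphism of a semigroup $S$ is a homomorphism $S\to S$; it is a monoid endomorphism if it fixes the identity. Maps are written on the right of their arguments: $(x)\varepsilon$. For a positive integer $k$, the map $\alpha_{[k]}\colon\boldsymbol{B}_{\omega}^{\mathscr{F}^3}\to\boldsymbol{B}_{\omega}^{\mathscr{F}^3}$ is defined, for all $i,j\in\omega$, by $(i,j,[p))\alpha_{[k]}=(ki,kj,[p))$ if $p\in\{0,1\}$, and $(i,j,[2))\alpha_{[k]}=(k(i+1)-1,k(j+1)-1,[2))$. *)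

theory Defs
  imports "HOL-Algebra.Group"
begin

text \<open>
  Subsets of \<open>\<omega>\<close> are represented as sets of integers, so that translates of them by a
  negative integer are again sets of the same type and nothing is truncated at 0.
\<close>

definition ray :: "nat \<Rightarrow> int set" where
  "ray a = {x. int a \<le> x}"

definition shift :: "int \<Rightarrow> int set \<Rightarrow> int set" where
  "shift n F = {n + k | k. k \<in> F}"

definition F3 :: "int set set" where
  "F3 = {ray 0, ray 1, ray 2}"

type_synonym triple = "nat \<times> nat \<times> int set"

text \<open>
  The summands of \<open>i\<^sub>1 - j\<^sub>1 + i\<^sub>2\<close> and \<open>j\<^sub>1 - i\<^sub>2 + j\<^sub>2\<close> are arranged such that the
  subtraction of natural numbers is exact in the respective branch. For \<open>j\<^sub>1 = i\<^sub>2\<close> the two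
  branches agree, see the lemma below.
\<close>

fun B_mult :: "triple \<Rightarrow> triple \<Rightarrow> triple" where
  "B_mult (i1, j1, F1) (i2, j2, F2) =
     (if j1 \<le> i2 then (i1 + (i2 - j1), j2, shift (int j1 - int i2) F1 \<inter> F2)
      else (i1, (j1 - i2) + j2, F1 \<inter> shift (int i2 - int j1) F2))"

definition B_F3 :: "triple monoid" where
  "B_F3 = \<lparr>carrier = UNIV \<times> UNIV \<times> F3, mult = B_mult, one = (0, 0, ray 0)\<rparr>"

text \<open>For \<open>k > 0\<close> the subtraction of 1 is exact.\<close>

fun alpha :: "nat \<Rightarrow> triple \<Rightarrow> triple" where
  "alpha k (i, j, F) =
     (if F = ray 2 then (k * (i + 1) - 1, k * (j + 1) - 1, ray 2) else (k * i, k * j, F))"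

lemma B_mult_ge:
  assumes "i2 \<le> j1"
  shows "B_mult (i1, j1, F1) (i2, j2, F2) =
    (i1, (j1 - i2) + j2, F1 \<inter> shift (int i2 - int j1) F2)"
  using assms by (auto simp: shift_def)

lemma ray_eq_iff [simp]: "ray a = ray b \<longleftrightarrow> a = b"
proof
  assume "ray a = ray b"
  moreover have "int a \<in> ray a" "int b \<in> ray b" by (auto simp: ray_def)
  ultimately have "int a \<in> ray b" "int b \<in> ray a" by auto
  then show "a = b" by (simp add: ray_def)
qed simp

lemma mem_shift_iff: "x \<in> shift n F \<longleftrightarrow> x - n \<in> F"
proof
  assume "x - n \<in> F"
  moreover have "x = n + (x - n)" by simp
  ultimately show "x \<in> shift n F" unfolding shift_def by blast
qed (auto simp: shift_def)

lemma shift_ray_Int_ray: "shift (- int d) (ray a) \<inter> ray b = ray (max (a - d) b)"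
proof (rule Set.set_eqI)
  fix x :: int
  have "x \<in> shift (- int d) (ray a) \<inter> ray b \<longleftrightarrow> int a \<le> x + int d \<and> int b \<le> x"
    by (simp add: mem_shift_iff ray_def)
  also have "\<dots> \<longleftrightarrow> int (max (a - d) b) \<le> x"
    by linarith
  finally show "x \<in> shift (- int d) (ray a) \<inter> ray b \<longleftrightarrow> x \<in> ray (max (a - d) b)"
    by (simp add: ray_def)
qed

lemma F3_iff: "F \<in> F3 \<longleftrightarrow> (\<exists>p\<le>2. F = ray p)"
  by (auto simp: F3_def numeral_2_eq_2 le_Suc_eq)

lemma B_mult_ray:
  "B_mult (i1, j1, ray p1) (i2, j2, ray p2) =
     (i1 + (i2 - j1), (j1 - i2) + j2, ray (max (p1 - (i2 - j1)) (p2 - (j1 - i2))))"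
proof (cases "j1 \<le> i2")
  case True
  then show ?thesis
    using shift_ray_Int_ray[of "i2 - j1" p1 p2] by simp
next
  case False
  then show ?thesis
    using shift_ray_Int_ray[of "j1 - i2" p2 p1]
    by (simp add: Int_commute max.commute)
qed

lemma max_diff: "max x y - z = max (x - z) (y - z)" for x y z :: nat
  by (simp add: max_def)

lemma add_minus_swap: "d + (e - d) = e + (d - e)" for d e :: nat
  by simp

lemma monoid_B_F3: "monoid B_F3"
proof (rule monoidI)
  fix x y assume "x \<in> carrier B_F3" "y \<in> carrier B_F3"
  then obtain i j p k l q where "x = (i, j, ray p)" "p \<le> 2" "y = (k, l, ray q)" "q \<le> 2"
    by (auto simp: B_F3_def F3_iff)
  then show "x \<otimes>\<^bsub>B_F3\<^esub> y \<in> carrier B_F3"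
    by (auto simp: B_F3_def F3_iff B_mult_ray simp del: B_mult.simps)
next
  fix x y z assume "x \<in> carrier B_F3" "y \<in> carrier B_F3" "z \<in> carrier B_F3"
  then obtain i j p k l q m n r where "x = (i, j, ray p)" "y = (k, l, ray q)" "z = (m, n, ray r)"
    by (auto simp: B_F3_def F3_iff)
  moreover have "(\<exists>d. k = j + d) \<or> (\<exists>d. j = k + d)" "(\<exists>e. m = l + e) \<or> (\<exists>e. l = m + e)"
    by presburger+
  ultimately show "x \<otimes>\<^bsub>B_F3\<^esub> y \<otimes>\<^bsub>B_F3\<^esub> z = x \<otimes>\<^bsub>B_F3\<^esub> (y \<otimes>\<^bsub>B_F3\<^esub> z)"
    by (elim disjE exE)
      (simp_all add: B_F3_def B_mult_ray max_diff max.assoc add_minus_swap del: B_mult.simps,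
        simp only: add.commute)
next
  show "\<one>\<^bsub>B_F3\<^esub> \<in> carrier B_F3"
    by (simp add: B_F3_def F3_def)
next
  fix x assume "x \<in> carrier B_F3"
  then obtain i j p where "x = (i, j, ray p)"
    by (auto simp: B_F3_def F3_iff)
  then show "\<one>\<^bsub>B_F3\<^esub> \<otimes>\<^bsub>B_F3\<^esub> x = x" and "x \<otimes>\<^bsub>B_F3\<^esub> \<one>\<^bsub>B_F3\<^esub> = x"
    by (simp_all add: B_F3_def B_mult_ray del: B_mult.simps)
qed

end

theory Submission
  imports Defs
begin

text \<open>
  Writing \<open>p\<close> for \<open>[p)\<close>, every element factors as
  \<open>(i, j, p) = (1, 0, 0)\<^sup>i (0, 0, p) (0, 1, 0)\<^sup>j\<close>. From \<open>(0, 1, 0)(1, 0, 0) = 1\<close> the images of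
  the two outer generators are \<open>(0, k, 0)\<close> and \<open>(k, 0, 0)\<close>, and the idempotent \<open>(0, 0, p)\<close> goes
  to an idempotent \<open>(c\<^sub>p, c\<^sub>p, q\<^sub>p)\<close>. The single relation \<open>(0, 0, 2)(1, 1, 0) = (1, 1, 1)\<close> together
  with injectivity then forces \<open>c\<^sub>1 = 0\<close>, \<open>q\<^sub>1 = 1\<close>, \<open>c\<^sub>2 = k - 1\<close> and \<open>q\<^sub>2 = 2\<close>.
\<close>

lemma carrier_B_F3_iff: "x \<in> carrier B_F3 \<longleftrightarrow> (\<exists>i j p. p \<le> 2 \<and> x = (i, j, ray p))"
  by (cases x) (auto simp: B_F3_def F3_iff)

lemma ray_in_carrier_B_F3: "p \<le> 2 \<Longrightarrow> (i, j, ray p) \<in> carrier B_F3"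
  by (auto simp: carrier_B_F3_iff)

lemma hom_B_F3_mult:
  assumes "\<epsilon> \<in> hom B_F3 B_F3" and "p \<le> 2" "q \<le> 2"
  shows "\<epsilon> (B_mult (i, j, ray p) (k, l, ray q)) = B_mult (\<epsilon> (i, j, ray p)) (\<epsilon> (k, l, ray q))"
  using hom_mult[OF assms(1) ray_in_carrier_B_F3[OF assms(2)] ray_in_carrier_B_F3[OF assms(3)]]
  by (simp add: B_F3_def del: B_mult.simps)

text \<open>A sum or maximum of naturals vanishes only termwise. The truncated differences
  \<open>c - b\<close> and \<open>b - c\<close> are then both zero, so neither ray gets shifted and
  both levels must be 0.\<close>

lemma B_mult_eq_one_imp:
  assumes "B_mult (a, b, ray p) (c, d, ray q) = (0, 0, ray 0)"
  shows "a = 0" "d = 0" "c = b" "p = 0" "q = 0"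
proof -
  from assms have "a + (c - b) = 0" "(b - c) + d = 0" "max (p - (c - b)) (q - (b - c)) = 0"
    by (auto simp add: B_mult_ray simp del: B_mult.simps)
  then show "a = 0" "d = 0" "c = b" "p = 0" "q = 0"
    by linarith+
qed

lemma B_mult_idem_imp:
  assumes "B_mult (a, b, ray p) (a, b, ray p) = (a, b, ray p)"
  shows "a = b"
  using assms by (simp add: B_mult_ray del: B_mult.simps)

text \<open>Reduces the problem to finitely many numbers: \<open>k\<close>, and \<open>c p\<close>,
  \<open>q p\<close> for the three levels \<open>p\<close>.\<close>

lemma monoid_endomorphism_B_F3_form:
  assumes hom: "\<epsilon> \<in> hom B_F3 B_F3" and one: "\<epsilon> \<one>\<^bsub>B_F3\<^esub> = \<one>\<^bsub>B_F3\<^esub>"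
  obtains k c q where "\<And>p. p \<le> 2 \<Longrightarrow> q p \<le> 2"
    and "\<And>i j p. p \<le> 2 \<Longrightarrow> \<epsilon> (i, j, ray p) = (c p + k * i, c p + k * j, ray (q p))"
proof -
  note [simp del] = B_mult.simps
  have img: "\<exists>a b r. r \<le> 2 \<and> \<epsilon> (i, j, ray p) = (a, b, ray r)" if "p \<le> 2" for i j p
    using hom_in_carrier[OF hom ray_in_carrier_B_F3[OF that]] by (auto simp: carrier_B_F3_iff)
  have one': "\<epsilon> (0, 0, ray 0) = (0, 0, ray 0)"
    using one by (simp add: B_F3_def)
  note mult = hom_B_F3_mult[OF hom]
  obtain a b p c d q where xy: "\<epsilon> (0, Suc 0, ray 0) = (a, b, ray p)" "\<epsilon> (Suc 0, 0, ray 0) = (c, d, ray q)"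
    using img[of 0 0 "Suc 0"] img[of 0 "Suc 0" 0] by auto
  have "B_mult (a, b, ray p) (c, d, ray q) = (0, 0, ray 0)"
    using mult[of 0 0 0 "Suc 0" "Suc 0" 0] by (auto simp: xy one' B_mult_ray)
  \<comment> \<open>Only \<open>b\<close> survives, and it becomes the \<open>k\<close> of the
    conclusion.\<close>
  note outer = xy[unfolded B_mult_eq_one_imp[OF this]]
  have right: "\<epsilon> (0, n, ray 0) = (0, b * n, ray 0)" for n
  proof (induction n)
    case (Suc n)
    then show ?case
      using mult[of 0 0 0 n 0 1] by (simp add: outer(1) B_mult_ray add.commute)
  qed (simp add: one')
  have left: "\<epsilon> (n, 0, ray 0) = (b * n, 0, ray 0)" for n
  proof (induction n)
    case (Suc n)
    then show ?case
      using mult[of 0 0 1 0 n 0] by (simp add: outer(2) B_mult_ray)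
  qed (simp add: one')
  have "\<exists>c q. q \<le> 2 \<and> \<epsilon> (0, 0, ray p) = (c, c, ray q)" if p: "p \<le> 2" for p
  proof -
    obtain a b r where r: "r \<le> 2" and \<epsilon>: "\<epsilon> (0, 0, ray p) = (a, b, ray r)"
      using img[OF p] by blast
    have "B_mult (a, b, ray r) (a, b, ray r) = (a, b, ray r)"
      using mult[OF p p, of 0 0 0 0] by (simp add: \<epsilon> B_mult_ray)
    from B_mult_idem_imp[OF this] show ?thesis
      using r \<epsilon> by blast
  qed
  then have "\<forall>p. \<exists>c q. p \<le> 2 \<longrightarrow> q \<le> 2 \<and> \<epsilon> (0, 0, ray p) = (c, c, ray q)"
    by blast
  then obtain c q where cq: "\<And>p. p \<le> 2 \<Longrightarrow> q p \<le> 2"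
    "\<And>p. p \<le> 2 \<Longrightarrow> \<epsilon> (0, 0, ray p) = (c p, c p, ray (q p))"
    by metis
  have "\<epsilon> (i, j, ray p) = (c p + b * i, c p + b * j, ray (q p))" if p: "p \<le> 2" for i j p
  proof -
    have "\<epsilon> (i, 0, ray p) = (c p + b * i, c p, ray (q p))"
      using mult[of 0 p i 0 0 0] p by (simp add: left cq(2) B_mult_ray add.commute)
    then show ?thesis
      using mult[of p 0 i 0 0 j] p by (simp add: right B_mult_ray)
  qed
  with cq(1) show thesis
    by (rule that)
qed

theorem theorem5:
  fixes \<epsilon> :: "triple \<Rightarrow> triple"
  assumes "\<epsilon> \<in> hom B_F3 B_F3"
    and "\<epsilon> \<one>\<^bsub>B_F3\<^esub> = \<one>\<^bsub>B_F3\<^esub>"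
    and "inj_on \<epsilon> (carrier B_F3)"
  shows "\<exists>k::nat. k > 0 \<and> (\<forall>x\<in>carrier B_F3. \<epsilon> x = alpha k x)"
proof -
  obtain k c q where q: "\<And>p. p \<le> 2 \<Longrightarrow> q p \<le> 2"
    and \<epsilon>: "\<And>i j p. p \<le> 2 \<Longrightarrow> \<epsilon> (i, j, ray p) = (c p + k * i, c p + k * j, ray (q p))"
    by (rule monoid_endomorphism_B_F3_form[OF assms(1,2)]) (rule that)
  have inj: "\<epsilon> (i, j, ray p) \<noteq> \<epsilon> (i', j', ray p')"
    if "p \<le> 2" "p' \<le> 2" "(i, j, p) \<noteq> (i', j', p')" for i j p i' j' p'
    using that by (auto simp: inj_on_eq_iff[OF assms(3)] ray_in_carrier_B_F3)
  have c0: "c 0 = 0" "q 0 = 0"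
    using assms(2) \<epsilon>[of 0 0 0] by (simp_all add: B_F3_def)
  have "k > 0"
    using inj[of 0 0 0 0 1 0] by (auto simp: \<epsilon>)
  have "B_mult (c 2, c 2, ray (q 2)) (k, k, ray 0) = (c 1 + k, c 1 + k, ray (q 1))"
    using hom_B_F3_mult[OF assms(1), of 2 0 0 0 1 1]
    by (simp add: \<epsilon> c0 B_mult_ray del: B_mult.simps)
  then have rel: "max (c 2) k = c 1 + k" "q 1 = q 2 - (k - c 2)"
    by (auto simp: B_mult_ray simp del: B_mult.simps)
  \<comment> \<open>Otherwise \<open>(0, 0, ray 2)\<close> and \<open>(1, 1, ray 1)\<close> would
    have the same image. By \<open>rel\<close>, this excludes \<open>k \<le> c 2\<close>, and hence
    \<open>c 1 = 0\<close>.\<close>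
  have "\<not> (c 2 = c 1 + k \<and> q 2 = q 1)"
    using inj[of 1 2 1 1 0 0] by (auto simp: \<epsilon>)
  moreover have "\<not> (c 1 = 0 \<and> q 1 = 0)"
    using inj[of 1 0 0 0 0 0] by (auto simp: \<epsilon> c0)
  moreover have "q 2 \<le> 2"
    using q by simp
  \<comment> \<open>Now \<open>k - c 2\<close> is at least 1, and
    \<open>q 1 = q 2 - (k - c 2)\<close> is positive; with \<open>q 2 \<le> 2\<close> this leaves
    only \<open>q 2 = 2\<close> and \<open>k - c 2 = 1\<close>.\<close>
  ultimately have cq: "c 1 = 0" "q 1 = 1" "c 2 = k - 1" "q 2 = 2"
    using rel \<open>k > 0\<close> by (auto simp: max_def split: if_splits)
  have "\<epsilon> x = alpha k x" if x: "x \<in> carrier B_F3" for x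
  proof -
    obtain i j p where "p \<le> 2" and x: "x = (i, j, ray p)"
      using x by (auto simp: carrier_B_F3_iff)
    then consider "p = 0" | "p = 1" | "p = 2"
      by linarith
    then show ?thesis
      \<comment> \<open>At level 2, positivity of \<open>k\<close> makes the truncated
        \<open>k - 1 + k * i\<close> equal to \<open>k * (i + 1) - 1\<close>.\<close>
      using \<open>k > 0\<close> by cases (auto simp: x \<epsilon> c0 cq algebra_simps simp del: One_nat_def)
  qed
  with \<open>k > 0\<close> show ?thesis
    by blast
qed

end
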